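(* Let $k\ge1$ be an integer and assume Erd\H{o}s' girth conjecture. In the simultaneous message-passing model with $s$ players and no edge duplication, the randomized communication complexity of the multiplicative $(2k-1)$-approximate distance oracle problem on $n$-vertex graphs is $\Omega(s n^{1+1/k})$ bits.
   Context: Message-passing model: players $P^1,\dots,P^s$ and a coordinator; all know the vertex set $V$, $|V|=n$; player $P^i$ holds an edge set $E_i$, pairwise disjoint (no duplication), and the input graph is $G=(V,\bigcup_i E_i)$ (unweighted, undirected). In the simultaneous variant each player sends a single message (depending only on its input and randomness) to the coordinator, who must then produce the output; communication cost is the total number of bits sent; randomized protocols must succeed with constant probability. In the multiplicative $(2k-1)$-approximate distance oracle problem, the coordinator must produce an oracle $O_G$ which, for any pair of vertices $v,w$, returns a value with $d_G(v,w)\le O_G(v,w)\le (2k-1)\,d_G(v,w)$. Erd\H{o}s' girth conjecture: for every integer $k\ge1$ and every $n$ there is an $n$-vertex graph with $\Omega(n^{1+1/k})$ edges and girth $2k+2$. Standing assumption: $s\ll n$ (e.g. $s=O(n^{\varepsilon})$ for a small constant $\varepsilon$). *)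

theory Defs
  imports "HOL-Probability.Probability_Mass_Function" "HOL-Library.Landau_Symbols"
begin

text \<open>
  A simple undirected graph with vertex set \<open>{..<n}\<close> is given by its edge set,
  a subset of \<open>all_edges n\<close>.
\<close>

definition all_edges :: "nat \<Rightarrow> nat set set" where
  "all_edges n = {{u, v} | u v. u < n \<and> v < n \<and> u \<noteq> v}"

definition walk :: "nat set set \<Rightarrow> nat \<Rightarrow> nat \<Rightarrow> nat list \<Rightarrow> bool" where
  "walk E v w xs \<longleftrightarrow>
     xs \<noteq> [] \<and> hd xs = v \<and> last xs = w \<and> successively (\<lambda>x y. {x, y} \<in> E) xs"

text \<open>The infimum over the empty set is \<open>\<infinity>\<close>: vertices in different components
  are at distance \<open>\<infinity>\<close>, and a forest has girth \<open>\<infinity>\<close>.\<close>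

definition graph_dist :: "nat set set \<Rightarrow> nat \<Rightarrow> nat \<Rightarrow> enat" where
  "graph_dist E v w = (INF xs \<in> {xs. walk E v w xs}. enat (length xs - 1))"

definition graph_cycle :: "nat set set \<Rightarrow> nat list \<Rightarrow> bool" where
  "graph_cycle E xs \<longleftrightarrow>
     length xs \<ge> 3 \<and> distinct xs \<and> successively (\<lambda>x y. {x, y} \<in> E) xs \<and> {last xs, hd xs} \<in> E"

definition girth :: "nat set set \<Rightarrow> enat" where
  "girth E = (INF xs \<in> {xs. graph_cycle E xs}. enat (length xs))"

text \<open>The bound is asymptotic in \<open>n\<close>: a graph with fewer than \<open>2k+2\<close> vertices
  cannot have girth \<open>2k+2\<close>.\<close>

definition erdos_girth_conjecture :: bool where
  "erdos_girth_conjecture \<longleftrightarrow>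
     (\<forall>k::nat. k \<ge> 1 \<longrightarrow>
       (\<exists>c::real. c > 0 \<and>
         (\<forall>\<^sub>F n in sequentially. \<exists>E \<subseteq> all_edges n.
             girth E = enat (2 * k + 2) \<and> real (card E) \<ge> c * real n powr (1 + 1 / real k))))"

definition approx_oracle ::
  "nat \<Rightarrow> nat \<Rightarrow> nat set set \<Rightarrow> (nat \<Rightarrow> nat \<Rightarrow> ereal) \<Rightarrow> bool" where
  "approx_oracle k n E Or \<longleftrightarrow>
     (\<forall>v<n. \<forall>w<n. ereal_of_enat (graph_dist E v w) \<le> Or v w \<and>
                  Or v w \<le> ereal (2 * real k - 1) * ereal_of_enat (graph_dist E v w))"

text \<open>
  A simultaneous protocol for players \<open>0, \<dots>, s - 1\<close>. Player \<open>i\<close> reads its own random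
  string \<open>\<omega> i\<close> and the coordinator reads \<open>\<omega> s\<close>. The joint distribution of the strings
  is arbitrary (but independent of the input), so that private coins (independent
  components) and public coins (identical components) are both covered.
\<close>

record protocol =
  coins :: "(nat \<Rightarrow> nat) pmf"
  message :: "nat \<Rightarrow> nat set set \<Rightarrow> nat \<Rightarrow> bool list"
  coordinator :: "bool list list \<Rightarrow> nat \<Rightarrow> (nat \<Rightarrow> nat \<Rightarrow> ereal)"

definition messages ::
  "protocol \<Rightarrow> nat \<Rightarrow> (nat \<Rightarrow> nat set set) \<Rightarrow> (nat \<Rightarrow> nat) \<Rightarrow> bool list list" where
  "messages P s E \<omega> = map (\<lambda>i. message P i (E i) (\<omega> i)) [0..<s]"

definition inputs :: "nat \<Rightarrow> nat \<Rightarrow> (nat \<Rightarrow> nat set set) set" where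
  "inputs s n = {E. \<forall>i<s. E i \<subseteq> all_edges n}"

definition solves_oracle :: "nat \<Rightarrow> real \<Rightarrow> nat \<Rightarrow> nat \<Rightarrow> protocol \<Rightarrow> bool" where
  "solves_oracle k p s n P \<longleftrightarrow>
     (\<forall>E \<in> inputs s n. disjoint_family_on E {..<s} \<longrightarrow>
        measure_pmf.prob (coins P)
          {\<omega>. approx_oracle k n (\<Union>i<s. E i) (coordinator P (messages P s E \<omega>) (\<omega> s))} \<ge> p)"

text \<open>
  The cost is the worst-case total number of bits over all combinations of local inputs.
  As usual for promise problems, the promise (no edge duplication) only restricts the
  inputs on which the protocol has to be correct; a player cannot check it, so that for
  independent coins the cost is the sum of the maximal message lengths of the players.
\<close>

definition comm_cost :: "nat \<Rightarrow> nat \<Rightarrow> protocol \<Rightarrow> enat" where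
  "comm_cost s n P =
     (SUP E \<in> inputs s n. SUP \<omega> \<in> set_pmf (coins P).
        enat (\<Sum>m\<leftarrow>messages P s E \<omega>. length m))"

definition oracle_complexity :: "nat \<Rightarrow> real \<Rightarrow> nat \<Rightarrow> nat \<Rightarrow> nat" where
  "oracle_complexity k p s n =
     Inf {c. \<exists>P. solves_oracle k p s n P \<and> comm_cost s n P \<le> enat c}"

end

theory Submission
  imports Defs
begin

text \<open>
  Let \<open>G\<close> have \<open>m\<close> edges and girth greater than \<open>2k\<close>. A \<open>(2k-1)\<close>-approximate distance oracle
  for a subgraph of \<open>G\<close> determines that subgraph, because removing an edge moves its endpoints
  from distance \<open>1\<close> to distance at least \<open>2k\<close>. Hence, for fixed coins and with all other
  players holding the empty graph, a player whose messages have length at most \<open>L\<close> is decoded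
  correctly on fewer than \<open>2 ^ (L + 1)\<close> of the \<open>2 ^ m\<close> subgraphs. Averaging over coins,
  players and subgraphs, some fixed coins force a constant fraction of the players to have a
  message of length \<open>m - O(1)\<close> on some input; since the cost is a worst case over all
  combinations of local inputs, these lengths add up.
\<close>

section \<open>Distances in subgraphs of a graph of large girth\<close>

text \<open>Cutting out the closed detour between two occurrences of a vertex shortens a walk.
  Distances range over walks, whereas \<open>graph_cycle\<close> demands distinct vertices.\<close>

lemma walk_imp_path:
  assumes "walk E v w xs"
  shows "\<exists>ys. walk E v w ys \<and> distinct ys \<and> length ys \<le> length xs"
  using assms
proof (induction "length xs" arbitrary: xs rule: less_induct)
  case less
  show ?case
  proof (cases "distinct xs")
    case False
    then obtain as y bs cs where xs: "xs = as @ [y] @ bs @ [y] @ cs"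
      using not_distinct_decomp by blast
    have "walk E v w (as @ [y] @ cs)"
      using less.prems unfolding walk_def xs
      by (auto simp: successively_append_iff successively_Cons hd_append split: if_splits)
    from less.hyps[OF _ this] obtain ys
      where "walk E v w ys" "distinct ys" "length ys \<le> length (as @ [y] @ cs)"
      by (auto simp: xs)
    then show ?thesis by (intro exI[of _ ys]) (auto simp: xs)
  qed (use less.prems in blast)
qed

lemma graph_dist_edge_le:
  assumes "{u, v} \<in> E"
  shows "graph_dist E u v \<le> 1"
proof -
  have "walk E u v [u, v]" using assms by (simp add: walk_def)
  then have "graph_dist E u v \<le> enat (length [u, v] - 1)"
    unfolding graph_dist_def by (intro INF_lower) simp
  then show ?thesis by (simp add: one_enat_def)
qed

text \<open>A shorter walk, reduced to a path, would close up with the edge \<open>{u, v}\<close> to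
  a cycle in \<open>G\<close> on at most \<open>2 * k\<close> vertices.\<close>

lemma graph_dist_nonedge_ge:
  assumes girth: "girth G > enat (2 * k)" and "E \<subseteq> G" and "{u, v} \<in> G" "{u, v} \<notin> E" "u \<noteq> v"
  shows "graph_dist E u v \<ge> enat (2 * k)"
proof (rule ccontr)
  assume "\<not> ?thesis"
  then obtain xs where "walk E u v xs" and lt: "length xs - 1 < 2 * k"
    by (auto simp: graph_dist_def not_le INF_less_iff)
  from walk_imp_path[OF this(1)] obtain ys
    where ys: "walk E u v ys" "distinct ys" "length ys \<le> length xs" by blast
  \<comment> \<open>An empty list is no walk, one vertex means \<open>u = v\<close>, and two
    vertices mean \<open>{u, v} \<in> E\<close>; so the path has the three vertices that
    \<open>graph_cycle\<close> demands.\<close>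
  have "length ys \<noteq> 0" "length ys \<noteq> 1" "length ys \<noteq> 2"
    using ys(1) assms(4,5) by (auto simp: walk_def length_Suc_conv numeral_2_eq_2)
  then have "length ys \<ge> 3" by linarith
  moreover have "successively (\<lambda>x y. {x, y} \<in> G) ys"
    using ys(1) \<open>E \<subseteq> G\<close> unfolding walk_def
    by (auto elim!: successively_mono)
  ultimately have "graph_cycle G ys"
    using ys assms(3) by (auto simp: graph_cycle_def walk_def insert_commute)
  then have "girth G \<le> enat (length ys)"
    unfolding girth_def by (intro INF_lower) simp
  with girth have "2 * k < length ys"
    by (metis enat_ord_simps(2) less_le_trans)
  with lt ys(3) show False by linarith
qed

text \<open>An edge of \<open>S\<close> outside \<open>T\<close> would make \<open>Or u v\<close> at
  least \<open>2 * k\<close> because of \<open>T\<close> and at most \<open>2 * k - 1\<close>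
  because of \<open>S\<close>. The hypotheses are symmetric in \<open>S\<close> and
  \<open>T\<close>, so exchanging them yields equality.\<close>

lemma approx_oracle_subset:
  assumes girth: "girth G > enat (2 * k)" and G: "G \<subseteq> all_edges n" and "k \<ge> 1"
    and "S \<subseteq> G" "T \<subseteq> G"
    and S: "approx_oracle k n S Or" and T: "approx_oracle k n T Or"
  shows "S \<subseteq> T"
proof
  fix e assume "e \<in> S"
  then have "e \<in> G" using \<open>S \<subseteq> G\<close> by blast
  with G obtain u v where e: "e = {u, v}" "u < n" "v < n" "u \<noteq> v"
    by (auto simp: all_edges_def)
  show "e \<in> T"
  proof (rule ccontr)
    assume "e \<notin> T"
    then have "enat (2 * k) \<le> graph_dist T u v"
      using graph_dist_nonedge_ge[OF girth \<open>T \<subseteq> G\<close>] \<open>e \<in> G\<close> e by auto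
    then have "ereal_of_enat (enat (2 * k)) \<le> ereal_of_enat (graph_dist T u v)"
      by (simp only: ereal_of_enat_le_iff)
    also have "\<dots> \<le> Or u v"
      using T e by (auto simp: approx_oracle_def)
    also have "\<dots> \<le> ereal (2 * real k - 1) * ereal_of_enat (graph_dist S u v)"
      using S e by (auto simp: approx_oracle_def)
    also have "\<dots> \<le> ereal (2 * real k - 1) * ereal_of_enat 1"
      using graph_dist_edge_le[of u v S] \<open>e \<in> S\<close> e(1) \<open>k \<ge> 1\<close>
      by (intro ereal_mult_left_mono) (auto simp only: ereal_of_enat_le_iff, simp)
    also have "\<dots> = ereal (2 * real k - 1)"
      by (simp add: one_enat_def)
    finally show False by simp
  qed
qed

section \<open>Counting the subgraphs decoded with fixed coins\<close>

lemma card_bool_lists_le: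
  "finite {xs :: bool list. length xs \<le> L}" "card {xs :: bool list. length xs \<le> L} \<le> 2 ^ (L + 1)"
proof -
  have "card {xs :: bool list. length xs \<le> L} = (\<Sum>i\<le>L. 2 ^ i)"
    using card_lists_length_le[of "UNIV :: bool set" L] by simp
  also have "\<dots> \<le> (2::nat) ^ (L + 1)"
    by (induction L) auto
  finally show "card {xs :: bool list. length xs \<le> L} \<le> 2 ^ (L + 1)" .
  show "finite {xs :: bool list. length xs \<le> L}"
    using finite_lists_length_le[of "UNIV :: bool set" L] by simp
qed

text \<open>The hard inputs: the empty sets make the family disjoint, and the messages of the other
  players do not vary with \<open>S\<close>.\<close>

definition only_player :: "nat \<Rightarrow> nat set set \<Rightarrow> nat \<Rightarrow> nat set set" where
  "only_player i S = (\<lambda>j. if j = i then S else {})"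

definition decoded ::
  "nat \<Rightarrow> nat \<Rightarrow> protocol \<Rightarrow> nat \<Rightarrow> nat set set \<Rightarrow> (nat \<Rightarrow> nat) \<Rightarrow> nat \<Rightarrow> nat set set set" where
  "decoded k n P s G \<omega> i =
     {S. S \<subseteq> G \<and> approx_oracle k n S (coordinator P (messages P s (only_player i S) \<omega>) (\<omega> s))}"

text \<open>With fixed coins the message of player \<open>i\<close> determines the whole transcript,
  hence the oracle, hence \<open>S\<close>. So decoded subgraphs have distinct messages.\<close>

lemma card_decoded_le:
  assumes girth: "girth G > enat (2 * k)" and G: "G \<subseteq> all_edges n" and "k \<ge> 1"
    and L: "\<And>S. S \<subseteq> G \<Longrightarrow> length (message P i S (\<omega> i)) \<le> L"
  shows "card (decoded k n P s G \<omega> i) \<le> 2 ^ (L + 1)"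
proof -
  let ?D = "decoded k n P s G \<omega> i" and ?f = "\<lambda>S. message P i S (\<omega> i)"
  have "inj_on ?f ?D"
  proof (rule inj_onI)
    fix S T assume S: "S \<in> ?D" and T: "T \<in> ?D" and eq: "?f S = ?f T"
    have "messages P s (only_player i S) \<omega> = messages P s (only_player i T) \<omega>"
      using eq by (simp add: messages_def only_player_def)
    with S T show "S = T"
      unfolding decoded_def
      using approx_oracle_subset[OF girth G \<open>k \<ge> 1\<close>]
      by (metis (no_types, lifting) mem_Collect_eq subset_antisym)
  qed
  moreover have "?f ` ?D \<subseteq> {xs. length xs \<le> L}"
    using L by (auto simp: decoded_def)
  ultimately have "card ?D \<le> card {xs :: bool list. length xs \<le> L}"
    using card_bool_lists_le(1) by (rule card_inj_on_le)
  also have "\<dots> \<le> 2 ^ (L + 1)" by (rule card_bool_lists_le)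
  finally show ?thesis .
qed

lemma sum_message_lengths_le:
  assumes "comm_cost s n P \<le> enat c" and "\<omega> \<in> set_pmf (coins P)" and "E \<in> inputs s n"
  shows "(\<Sum>i<s. length (message P i (E i) (\<omega> i))) \<le> c"
proof -
  have "enat (\<Sum>m\<leftarrow>messages P s E \<omega>. length m) \<le> comm_cost s n P"
    unfolding comm_cost_def by (rule SUP_upper2[OF assms(3)], rule SUP_upper[OF assms(2)])
  with assms(1) have "(\<Sum>m\<leftarrow>messages P s E \<omega>. length m) \<le> c"
    by (metis enat_ord_simps(1) order_trans)
  then show ?thesis
    by (simp add: messages_def comp_def interv_sum_list_conv_sum_set_nat atLeast0LessThan)
qed

lemma finite_all_edges: "finite (all_edges n)"
  by (rule finite_subset[of _ "Pow {..<n}"]) (auto simp: all_edges_def)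

text \<open>Let \<open>L i\<close> be the longest message of player \<open>i\<close>. If it falls
  short of \<open>card G\<close> by at least \<open>1 + q\<close> bits, at most a fraction
  \<open>p / 2\<close> of the subgraphs is decoded; otherwise \<open>L i / T \<ge> 1\<close> and the
  trivial count suffices. The sum of both terms covers either case and is linear in
  \<open>L i\<close>, so only the total length matters.\<close>

lemma sum_card_decoded_le:
  assumes girth: "girth G > enat (2 * k)" and G: "G \<subseteq> all_edges n" and "k \<ge> 1"
    and cost: "comm_cost s n P \<le> enat c" and \<omega>: "\<omega> \<in> set_pmf (coins P)"
    and q: "(1 / 2) ^ q \<le> p / 2" and T: "T = real (card G) - 1 - real q" "T > 0"
  shows "(\<Sum>i<s. real (card (decoded k n P s G \<omega> i)))
           \<le> (real s * p / 2 + real c / T) * 2 ^ card G"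
proof -
  have fin: "finite G" using G finite_all_edges finite_subset by blast
  define len where "len i S = length (message P i S (\<omega> i))" for i S
  have "\<exists>S. S \<subseteq> G \<and> (\<forall>S'. S' \<subseteq> G \<longrightarrow> len i S' \<le> len i S)" for i
    using Max_in[of "len i ` Pow G"] Max_ge[of "len i ` Pow G"] fin
    by (smt (verit, best) Pow_iff empty_subsetI finite_Pow_iff finite_imageI imageE image_eqI
        image_is_empty Pow_not_empty)
  then obtain S where S: "\<And>i. S i \<subseteq> G" "\<And>i S'. S' \<subseteq> G \<Longrightarrow> len i S' \<le> len i (S i)"
    by metis
  define L where "L i = len i (S i)" for i
  \<comment> \<open>The maximizers \<open>S i\<close> may share edges; \<open>inputs\<close> admits
    such families, so all the longest messages occur in one run and their total is at most
    \<open>c\<close>.\<close>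
  have "S \<in> inputs s n" using S(1) G by (auto simp: inputs_def)
  from sum_message_lengths_le[OF cost \<omega> this] have "(\<Sum>i<s. L i) \<le> c"
    by (simp add: L_def len_def)
  then have Lc: "(\<Sum>i<s. real (L i)) \<le> real c"
    by (metis of_nat_le_iff of_nat_sum)
  have p: "0 \<le> p / 2" using q by (rule order_trans[rotated]) simp
  have "real (card (decoded k n P s G \<omega> i)) \<le> (p / 2 + real (L i) / T) * 2 ^ card G" for i
  proof (cases "L i + 1 + q \<le> card G")
    case True
    have "card (decoded k n P s G \<omega> i) \<le> 2 ^ (L i + 1)"
      using S(2)[of _ i] by (intro card_decoded_le[OF girth G \<open>k \<ge> 1\<close>]) (simp add: L_def len_def)
    then have "real (card (decoded k n P s G \<omega> i)) \<le> 2 ^ (L i + 1)"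
      by (metis of_nat_le_iff of_nat_numeral of_nat_power)
    also have "\<dots> = (1 / 2) ^ q * 2 ^ (L i + 1 + q)"
      by (simp add: power_add power_one_over)
    also have "\<dots> \<le> (p / 2 + real (L i) / T) * 2 ^ card G"
      using q p True T(2) by (intro mult_mono power_increasing add_increasing2 add_nonneg_nonneg) auto
    finally show ?thesis .
  next
    case False
    then have "T \<le> real (L i)" using T(1) by linarith
    then have "1 \<le> real (L i) / T" using T(2) by simp
    then have "1 \<le> p / 2 + real (L i) / T" using p by linarith
    moreover have "card (decoded k n P s G \<omega> i) \<le> card (Pow G)"
      using fin by (intro card_mono) (auto simp: decoded_def)
    then have "real (card (decoded k n P s G \<omega> i)) \<le> 1 * 2 ^ card G"
      using fin by (simp add: card_Pow flip: of_nat_le_iff)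
    ultimately show ?thesis
      by (meson mult_right_mono order_trans zero_le_numeral zero_le_power)
  qed
  then have "(\<Sum>i<s. real (card (decoded k n P s G \<omega> i)))
      \<le> (\<Sum>i<s. (p / 2 + real (L i) / T) * 2 ^ card G)"
    by (intro sum_mono) auto
  also have "\<dots> = (real s * p / 2 + (\<Sum>i<s. real (L i)) / T) * 2 ^ card G"
    by (simp add: sum_distrib_right[symmetric] sum.distrib sum_divide_distrib)
  also have "\<dots> \<le> (real s * p / 2 + real c / T) * 2 ^ card G"
    using Lc T(2) by (intro mult_right_mono add_left_mono divide_right_mono) auto
  finally show ?thesis .
qed

section \<open>Lower bound on, and finiteness of, the cost of randomized protocols\<close>

text \<open>Count pairs of a player and a subgraph that are decoded. Correctness makes the expected
  number at least \<open>s * p * 2 ^ card G\<close>, while \<open>sum_card_decoded_le\<close> bounds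
  it for each outcome of the coins. The latter bound is pointwise, so dependent coins are covered
  too.\<close>

lemma comm_cost_lower_bound:
  assumes girth: "girth G > enat (2 * k)" and G: "G \<subseteq> all_edges n" and "k \<ge> 1"
    and solves: "solves_oracle k p s n P" and cost: "comm_cost s n P \<le> enat c"
    and q: "(1 / 2) ^ q \<le> p / 2" and T: "T = real (card G) - 1 - real q" "T > 0"
  shows "real s * p * T / 2 \<le> real c"
proof -
  have fin: "finite G" using G finite_all_edges finite_subset by blast
  let ?M = "measure_pmf (coins P)"
  define A where "A i S = {\<omega>. S \<in> decoded k n P s G \<omega> i}" for i S
  have prob: "p \<le> measure ?M (A i S)" if "i < s" "S \<subseteq> G" for i S
  proof -
    have "only_player i S \<in> inputs s n"
      using that G by (auto simp: inputs_def only_player_def)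
    moreover have "disjoint_family_on (only_player i S) {..<s}"
      by (auto simp: disjoint_family_on_def only_player_def)
    moreover have "(\<Union>j<s. only_player i S j) = S"
      using that by (auto simp: only_player_def split: if_splits)
    ultimately show ?thesis
      using solves that(2) by (fastforce simp: solves_oracle_def A_def decoded_def)
  qed
  \<comment> \<open>As a sum of indicators the count has an expectation that splits into the success
    probabilities.\<close>
  have card_eq: "real (card (decoded k n P s G \<omega> i)) = (\<Sum>S\<in>Pow G. indicator (A i S) \<omega>)" for \<omega> i
  proof -
    have "decoded k n P s G \<omega> i = {S \<in> Pow G. \<omega> \<in> A i S}"
      by (auto simp: A_def decoded_def)
    then show ?thesis
      using fin by (simp add: indicator_def sum.If_cases Int_def)
  qed
  have int: "integrable ?M (indicator (A i S) :: _ \<Rightarrow> real)" for i S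
    by (intro integrable_real_indicator) (auto simp: less_top[symmetric])
  have "real s * p * 2 ^ card G = (\<Sum>i<s. \<Sum>S\<in>Pow G. p)"
    using fin by (simp add: card_Pow)
  also have "\<dots> \<le> (\<Sum>i<s. \<Sum>S\<in>Pow G. measure ?M (A i S))"
    by (intro sum_mono prob) auto
  also have "\<dots> = (\<integral>\<omega>. (\<Sum>i<s. \<Sum>S\<in>Pow G. indicator (A i S) \<omega>) \<partial>?M)"
    by (simp add: int)
  also have "\<dots> = (\<integral>\<omega>. (\<Sum>i<s. real (card (decoded k n P s G \<omega> i))) \<partial>?M)"
    by (simp add: card_eq)
  also have "\<dots> \<le> (real s * p / 2 + real c / T) * 2 ^ card G"
  proof (rule measure_pmf.integral_le_const)
    show "integrable ?M (\<lambda>\<omega>. \<Sum>i<s. real (card (decoded k n P s G \<omega> i)))"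
      by (simp add: card_eq int)
    \<comment> \<open>Almost everywhere means on the support of the coins, which is where
      \<open>comm_cost\<close> bounds the messages.\<close>
    show "AE \<omega> in ?M. (\<Sum>i<s. real (card (decoded k n P s G \<omega> i)))
        \<le> (real s * p / 2 + real c / T) * 2 ^ card G"
      using sum_card_decoded_le[OF girth G \<open>k \<ge> 1\<close> cost _ q T] by (simp add: AE_measure_pmf_iff)
  qed
  finally have "real s * p \<le> real s * p / 2 + real c / T" by simp
  then have "real s * p / 2 \<le> real c / T" by linarith
  with T(2) show ?thesis by (simp add: field_simps)
qed

text \<open>Without such a protocol the infimum defining \<^const>\<open>oracle_complexity\<close> would be the
  junk value \<open>0\<close>. Every player sends its whole edge set, numbered in unary.\<close>

lemma finite_cost_protocol_exists:
  assumes "k \<ge> 1" "p \<le> 1"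
  shows "\<exists>c P. solves_oracle k p s n P \<and> comm_cost s n P \<le> enat c"
proof -
  have "finite (Pow (all_edges n))" by (simp add: finite_all_edges)
  from finite_imp_inj_to_nat_seg[OF this] obtain h :: "nat set set \<Rightarrow> nat" and N
    where h: "h ` Pow (all_edges n) = {i. i < N}" "inj_on h (Pow (all_edges n))" by blast
  define dec where "dec xs = inv_into (Pow (all_edges n)) h (length xs)" for xs :: "bool list"
  define P where "P = \<lparr>coins = return_pmf (\<lambda>_. 0),
      message = (\<lambda>i E r. replicate (h E) True),
      coordinator = (\<lambda>ms r v w. ereal_of_enat (graph_dist (\<Union>(dec ` set ms)) v w))\<rparr>"
  have exact: "approx_oracle k n E (\<lambda>v w. ereal_of_enat (graph_dist E v w))" for E
  proof -
    \<comment> \<open>Exact distances are admissible because \<open>2 * k - 1 \<ge> 1\<close>; this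
      includes infinite distances.\<close>
    have "ereal_of_enat d \<le> ereal (2 * real k - 1) * ereal_of_enat d" for d
      using \<open>k \<ge> 1\<close> ereal_mult_right_mono[of 1 "ereal (2 * real k - 1)" "ereal_of_enat d"]
      by simp
    then show ?thesis by (simp add: approx_oracle_def)
  qed
  have "solves_oracle k p s n P"
    unfolding solves_oracle_def
  proof (intro ballI impI)
    fix E assume E: "E \<in> inputs s n"
    have "(\<Union>i<s. dec (replicate (h (E i)) True)) = (\<Union>i<s. E i)"
      using E h(2) by (auto simp: dec_def inputs_def)
    then have "approx_oracle k n (\<Union>i<s. E i) (coordinator P (messages P s E \<omega>) (\<omega> s))" for \<omega>
      using exact[of "\<Union>i<s. E i"] by (simp add: P_def messages_def image_image atLeast0LessThan)
    then show "p \<le> measure_pmf.prob (coins P)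
        {\<omega>. approx_oracle k n (\<Union>i<s. E i) (coordinator P (messages P s E \<omega>) (\<omega> s))}"
      using \<open>p \<le> 1\<close> by simp
  qed
  moreover have "comm_cost s n P \<le> enat (s * N)"
    unfolding comm_cost_def
  proof (intro SUP_least)
    fix E \<omega> assume E: "E \<in> inputs s n"
    have "h (E i) \<le> N" if "i < s" for i
    proof -
      have "h (E i) \<in> h ` Pow (all_edges n)" using E that by (auto simp: inputs_def)
      then show ?thesis unfolding h(1) by simp
    qed
    then have "(\<Sum>i<s. h (E i)) \<le> (\<Sum>i<s. N)"
      by (intro sum_mono) simp
    then show "enat (\<Sum>m\<leftarrow>messages P s E \<omega>. length m) \<le> enat (s * N)"
      by (simp add: P_def messages_def comp_def interv_sum_list_conv_sum_set_nat atLeast0LessThan)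
  qed
  ultimately show ?thesis by blast
qed

section \<open>Asymptotics in the number of vertices\<close>

theorem theorem4p13:
  fixes k :: nat and p :: real and s :: "nat \<Rightarrow> nat"
  assumes "k \<ge> 1"
    and "erdos_girth_conjecture"
    and "0 < p" and "p \<le> 1"
    and "(\<lambda>n. real (s n)) \<in> o(\<lambda>n. real n)"
  shows "(\<lambda>n. real (oracle_complexity k p (s n) n))
           \<in> \<Omega>(\<lambda>n. real (s n) * real n powr (1 + 1 / real k))"
proof -
  obtain c :: real where c: "c > 0"
    and ev: "\<forall>\<^sub>F n in sequentially. \<exists>G \<subseteq> all_edges n.
      girth G = enat (2 * k + 2) \<and> real (card G) \<ge> c * real n powr (1 + 1 / real k)"
    using assms(1,2) unfolding erdos_girth_conjecture_def by blast
  \<comment> \<open>\<open>q\<close> depends on \<open>p\<close> alone, so the loss of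
    \<open>1 + q\<close> bits per player is constant in \<open>n\<close>.\<close>
  obtain q where q: "(1 / 2) ^ q \<le> p / 2"
    using real_arch_pow_inv[of "p / 2" "1 / 2"] \<open>0 < p\<close> by (auto intro: less_imp_le)
  have "\<forall>\<^sub>F n in sequentially. 2 * (2 + real q) / c \<le> real n"
    using filterlim_real_sequentially unfolding filterlim_at_top by blast
  with ev eventually_ge_at_top[of 1]
  have "\<forall>\<^sub>F n in sequentially. p * c / 4 * norm (real (s n) * real n powr (1 + 1 / real k))
      \<le> norm (real (oracle_complexity k p (s n) n))"
  proof eventually_elim
    case (elim n)
    then obtain G where G: "G \<subseteq> all_edges n" "girth G = enat (2 * k + 2)"
      and card: "c * real n powr (1 + 1 / real k) \<le> real (card G)" by blast
    have "real n \<le> real n powr (1 + 1 / real k)"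
      using elim(2) powr_mono[of 1 "1 + 1 / real k" "real n"] by simp
    then have "2 * (2 + real q) / c \<le> real n powr (1 + 1 / real k)"
      using elim(3) by linarith
    then have "2 * (2 + real q) \<le> c * real n powr (1 + 1 / real k)"
      using c by (simp add: field_simps)
    then have large: "2 * (2 + real q) \<le> real (card G)" using card by linarith
    \<comment> \<open>The threshold on \<open>n\<close> ensures that the loss \<open>1 + q\<close>
      is less than half of \<open>card G\<close>.\<close>
    define T where "T = real (card G) - 1 - real q"
    have T: "T > 0" "real (card G) / 2 \<le> T" using large by (auto simp: T_def)
    \<comment> \<open>An infimum of a nonempty set of naturals is attained, so some protocol
      realizes the complexity.\<close>
    have "oracle_complexity k p (s n) n
        \<in> {m. \<exists>P. solves_oracle k p (s n) n P \<and> comm_cost (s n) n P \<le> enat m}"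
      unfolding oracle_complexity_def
      using finite_cost_protocol_exists[OF \<open>k \<ge> 1\<close> \<open>p \<le> 1\<close>] by (intro Inf_nat_def1) blast
    then obtain P where "solves_oracle k p (s n) n P"
      "comm_cost (s n) n P \<le> enat (oracle_complexity k p (s n) n)" by blast
    then have bound: "real (s n) * p * T / 2 \<le> real (oracle_complexity k p (s n) n)"
      using G q T(1) \<open>k \<ge> 1\<close> by (intro comm_cost_lower_bound[OF _ G(1)]) (auto simp: T_def)
    \<comment> \<open>The factor \<open>1 / 4\<close> combines the half lost in
      \<open>comm_cost_lower_bound\<close> with the half in
      \<open>T \<ge> card G / 2\<close>.\<close>
    have "p * c / 4 * norm (real (s n) * real n powr (1 + 1 / real k))
        = real (s n) * p * (c * real n powr (1 + 1 / real k) / 2) / 2"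
      by simp
    also have "\<dots> \<le> real (s n) * p * T / 2"
      using card T(2) \<open>0 < p\<close> by (intro divide_right_mono mult_left_mono) auto
    also note bound
    finally show ?case by simp
  qed
  then show ?thesis
    using c \<open>0 < p\<close> by (intro landau_omega.bigI[of "p * c / 4"]) auto
qed

end
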